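(* (a) For every $q\ge1$, every $n\in\{1,2,3\}$ and every $q\times q$ Hurwitz-type matrix polynomial $\mathbf f_n(z)=I_qz^n+A_1z^{n-1}+\cdots+A_n$ of degree $n$, all coefficient matrices have strictly positive determinants: $\det A_j>0$ for all $j=1,\dots,n$ (and trivially $\det I_q>0$). (b) The assertion in (a) fails for degree $4$: there exist $q\ge 1$ and a $q\times q$ Hurwitz-type matrix polynomial $\mathbf f_4(z)=I_qz^4+A_1z^3+A_2z^2+A_3z+A_4$ of degree $4$ having a coefficient matrix with negative determinant.
   Context: **Hurwitz-type matrix (HTM) polynomials.** Let $\mathbf f_n(z)=I_qz^n+A_1z^{n-1}+\cdots+A_n$ with $A_j\in\mathbb C^{q\times q}$. Write $\mathbf f_n(z)=\mathbf h_n(z^2)+z\,\mathbf g_n(z^2)$, where for $n=2m$: $\mathbf h_n(z)=I_qz^m+A_2z^{m-1}+\cdots+A_{2m}$, $\mathbf g_n(z)=A_1z^{m-1}+A_3z^{m-2}+\cdots+A_{2m-1}$; and for $n=2m+1$: $\mathbf h_n(z)=A_1z^m+A_3z^{m-1}+\cdots+A_{2m+1}$, $\mathbf g_n(z)=I_qz^m+A_2z^{m-1}+\cdots+A_{2m}$. $\mathbf f_n$ is a Hurwitz-type matrix (HTM) polynomial if there are Hermitian positive definite $q\times q$ matrices $\mathbf c_0,\dots,\mathbf c_{m-1},\mathbf d_0,\dots,\mathbf d_{m-1}$ if $n=2m$ (resp. $\mathbf c_0,\dots,\mathbf c_m,\mathbf d_0,\dots,\mathbf d_{m-1}$ if $n=2m+1$)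 such that, as an identity of rational matrix functions, $\mathbf g_n(z)\mathbf h_n(z)^{-1}=K_0(z)$ (resp. $\mathbf h_n(z)(z\mathbf g_n(z))^{-1}=K_0(z)$), where $K_0$ is the finite continued fraction given by: for $n=2m$, $K_{m-1}(z)=(z\mathbf c_{m-1}+\mathbf d_{m-1}^{-1})^{-1}$ and $K_i(z)=\bigl(z\mathbf c_i+(\mathbf d_i+K_{i+1}(z))^{-1}\bigr)^{-1}$ for $i=m-2,\dots,0$; for $n=2m+1$, $K_m(z)=z^{-1}\mathbf c_m^{-1}$ and $K_i(z)=\bigl(z\mathbf c_i+(\mathbf d_i+K_{i+1}(z))^{-1}\bigr)^{-1}$ for $i=m-1,\dots,0$. *)

theory Defs
  imports
    "Jordan_Normal_Form.Gauss_Jordan_Elimination"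
    "Jordan_Normal_Form.Schur_Decomposition"
    "HOL-Computational_Algebra.Polynomial_Factorial"
begin

text \<open>
  A \<open>q \<times> q\<close> matrix polynomial is a matrix over \<^typ>\<open>complex poly\<close>, a rational matrix function is a
  matrix over the field \<^typ>\<open>complex poly fract\<close>.  The dimension \<open>q\<close> is a number (not a type), since
  it is quantified existentially in the theorem.

  The order on \<^typ>\<open>complex\<close> is the one of \<^theory>\<open>HOL-Library.Complex_Order\<close>: \<open>0 < x\<close> says
  that \<open>x\<close> is real and positive, \<open>x < 0\<close> that \<open>x\<close> is real and negative.
\<close>

definition herm_posdef :: "nat \<Rightarrow> complex mat \<Rightarrow> bool" where
  "herm_posdef q M \<longleftrightarrow> M \<in> carrier_mat q q \<and> mat_adjoint M = M \<and>
     (\<forall>v \<in> carrier_vec q. v \<noteq> 0\<^sub>v q \<longrightarrow> 0 < (M *\<^sub>v v) \<bullet>c v)"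

definition coeff_mat :: "complex poly mat \<Rightarrow> nat \<Rightarrow> complex mat" where
  "coeff_mat F k = map_mat (\<lambda>p. coeff p k) F"

text \<open>\<open>mat_poly q d B\<close> is \<open>B 0 z^d + B 1 z^(d-1) + \<dots> + B d\<close>, with \<open>q \<times> q\<close> coefficients.\<close>

definition mat_poly :: "nat \<Rightarrow> nat \<Rightarrow> (nat \<Rightarrow> complex mat) \<Rightarrow> complex poly mat" where
  "mat_poly q d B = mat q q (\<lambda>(r, s). \<Sum>k\<le>d. monom (B k $$ (r, s)) (d - k))"

definition monic_mat_poly :: "nat \<Rightarrow> nat \<Rightarrow> complex poly mat \<Rightarrow> bool" where
  "monic_mat_poly q n F \<longleftrightarrow> F \<in> carrier_mat q q \<and> coeff_mat F n = 1\<^sub>m q \<and>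
     (\<forall>k>n. coeff_mat F k = 0\<^sub>m q q)"

text \<open>The coefficient \<open>A\<^sub>j\<close> of \<open>F = I\<^sub>q z^n + A\<^sub>1 z^(n-1) + \<dots> + A\<^sub>n\<close>; here \<open>A\<^sub>0 = I\<^sub>q\<close>.\<close>

definition mp_coeff :: "nat \<Rightarrow> complex poly mat \<Rightarrow> nat \<Rightarrow> complex mat" where
  "mp_coeff n F j = coeff_mat F (n - j)"

definition h_part :: "nat \<Rightarrow> nat \<Rightarrow> complex poly mat \<Rightarrow> complex poly mat" where
  "h_part q n F =
     (if even n then mat_poly q (n div 2) (\<lambda>k. mp_coeff n F (2 * k))
      else mat_poly q (n div 2) (\<lambda>k. mp_coeff n F (2 * k + 1)))"

definition g_part :: "nat \<Rightarrow> nat \<Rightarrow> complex poly mat \<Rightarrow> complex poly mat" where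
  "g_part q n F =
     (if even n then mat_poly q (n div 2 - 1) (\<lambda>k. mp_coeff n F (2 * k + 1))
      else mat_poly q (n div 2) (\<lambda>k. mp_coeff n F (2 * k)))"

text \<open>
  The inverse of an invertible square matrix over a field, see \<open>mat_inv_eq\<close> below.  On singular
  matrices the value is unspecified.  This does not matter for Hurwitz-type matrix polynomials: as
  the \<open>c\<^sub>i\<close>, \<open>d\<^sub>i\<close> are positive definite and every \<open>K\<^sub>i\<close> vanishes at infinity, all
  inverses in the continued fraction exist, and so do those of the monic \<open>h\<^sub>n\<close> (\<open>n\<close> even)
  and \<open>z g\<^sub>n\<close> (\<open>n\<close> odd).
\<close>

definition mat_inv :: "'a :: field mat \<Rightarrow> 'a mat" where
  "mat_inv M = the (mat_inverse M)"

definition ratmat :: "complex poly mat \<Rightarrow> complex poly fract mat" where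
  "ratmat F = map_mat to_fract F"

definition const_ratmat :: "complex mat \<Rightarrow> complex poly fract mat" where
  "const_ratmat M = map_mat (\<lambda>a. to_fract [:a:]) M"

definition ratvar :: "complex poly fract" where
  "ratvar = to_fract [:0, 1:]"

text \<open>
  \<open>K_even c d m i\<close> and \<open>K_odd c d m i\<close> are the \<open>K\<^sub>i\<close> for \<open>n = 2m\<close> and \<open>n = 2m + 1\<close>; only the
  indices \<open>i \<le> m - 1\<close> and \<open>i \<le> m\<close>, respectively, are meaningful.
\<close>

function K_even ::
  "(nat \<Rightarrow> complex mat) \<Rightarrow> (nat \<Rightarrow> complex mat) \<Rightarrow> nat \<Rightarrow> nat \<Rightarrow> complex poly fract mat" where
  "K_even c d m i =
     (if m \<le> i + 1
      then mat_inv (ratvar \<cdot>\<^sub>m const_ratmat (c i) + const_ratmat (mat_inv (d i)))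
      else mat_inv (ratvar \<cdot>\<^sub>m const_ratmat (c i) +
             mat_inv (const_ratmat (d i) + K_even c d m (i + 1))))"
  by pat_completeness auto
termination by (relation "measure (\<lambda>(c, d, m, i). m - i)") auto

function K_odd ::
  "(nat \<Rightarrow> complex mat) \<Rightarrow> (nat \<Rightarrow> complex mat) \<Rightarrow> nat \<Rightarrow> nat \<Rightarrow> complex poly fract mat" where
  "K_odd c d m i =
     (if m \<le> i
      then inverse ratvar \<cdot>\<^sub>m const_ratmat (mat_inv (c i))
      else mat_inv (ratvar \<cdot>\<^sub>m const_ratmat (c i) +
             mat_inv (const_ratmat (d i) + K_odd c d m (i + 1))))"
  by pat_completeness auto
termination by (relation "measure (\<lambda>(c, d, m, i). m - i)") auto

declare K_even.simps [simp del] K_odd.simps [simp del]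

definition HTM_poly :: "nat \<Rightarrow> nat \<Rightarrow> complex poly mat \<Rightarrow> bool" where
  "HTM_poly q n F \<longleftrightarrow> 1 \<le> n \<and> monic_mat_poly q n F \<and>
     (let h = h_part q n F; g = g_part q n F; m = n div 2 in
      if even n then
        (\<exists>c d. (\<forall>i<m. herm_posdef q (c i)) \<and> (\<forall>i<m. herm_posdef q (d i)) \<and>
           ratmat g * mat_inv (ratmat h) = K_even c d m 0)
      else
        (\<exists>c d. (\<forall>i\<le>m. herm_posdef q (c i)) \<and> (\<forall>i<m. herm_posdef q (d i)) \<and>
           ratmat h * mat_inv (ratvar \<cdot>\<^sub>m ratmat g) = K_odd c d m 0))"

lemma mat_inv_eq:
  fixes M N :: "'a :: field mat"
  assumes M: "M \<in> carrier_mat q q" and N: "N \<in> carrier_mat q q" and MN: "M * N = 1\<^sub>m q"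
  shows "mat_inv M = N"
proof -
  have NM: "N * M = 1\<^sub>m q" using mat_mult_left_right_inverse[OF M N MN] .
  have "M \<in> Units (ring_mat TYPE('a) q ())"
    using M N MN NM by (auto simp: Units_def ring_mat_def)
  then obtain B where B: "mat_inverse M = Some B"
    using mat_inverse(1)[OF M, where b = "()"] by (cases "mat_inverse M") auto
  from mat_inverse(2)[OF M B] have BM: "B * M = 1\<^sub>m q" and Bc: "B \<in> carrier_mat q q" by auto
  have "B = B * (M * N)" using MN Bc by simp
  also have "\<dots> = N" using BM assoc_mult_mat[OF Bc M N] N by simp
  finally show ?thesis using B by (simp add: mat_inv_def)
qed

lemma mat_poly_mp_coeff:
  assumes "monic_mat_poly q n F"
  shows "F = mat_poly q n (mp_coeff n F)"
proof (rule eq_matI)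
  fix r s assume "r < dim_row (mat_poly q n (mp_coeff n F))" "s < dim_col (mat_poly q n (mp_coeff n F))"
  then have rs: "r < q" "s < q" by (auto simp: mat_poly_def)
  have F: "F \<in> carrier_mat q q" using assms by (simp add: monic_mat_poly_def)
  have z: "coeff (F $$ (r, s)) k = 0" if "k > n" for k
  proof -
    have "coeff_mat F k $$ (r, s) = 0" using assms that rs by (simp add: monic_mat_poly_def)
    then show ?thesis using F rs by (simp add: coeff_mat_def)
  qed
  have "(\<Sum>k\<le>n. monom (mp_coeff n F k $$ (r, s)) (n - k)) = (\<Sum>k\<le>n. monom (coeff (F $$ (r, s)) (n - k)) (n - k))"
    using F rs by (intro sum.cong) (auto simp: mp_coeff_def coeff_mat_def)
  also have "\<dots> = (\<Sum>k\<le>n. monom (coeff (F $$ (r, s)) k) k)"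
    by (rule sum.reindex_bij_witness[of _ "\<lambda>k. n - k" "\<lambda>k. n - k"]) auto
  also have "\<dots> = F $$ (r, s)"
    by (rule poly_as_sum_of_monoms') (use z in \<open>auto intro!: degree_le\<close>)
  finally show "F $$ (r, s) = mat_poly q n (mp_coeff n F) $$ (r, s)"
    using rs by (simp add: mat_poly_def)
qed (use assms in \<open>auto simp: mat_poly_def monic_mat_poly_def\<close>)

lemma coeff_mat_poly:
  assumes "r < q" "s < q"
  shows "coeff (mat_poly q d B $$ (r, s)) k = (if k \<le> d then B (d - k) $$ (r, s) else 0)"
proof -
  have "coeff (mat_poly q d B $$ (r, s)) k
      = (\<Sum>l\<le>d. if d - l = k then B l $$ (r, s) else 0)"
    using assms by (simp add: mat_poly_def coeff_sum)
  also have "\<dots> = (\<Sum>l\<le>d. if l = d - k then (if k \<le> d then B l $$ (r, s) else 0) else 0)"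
    by (intro sum.cong) auto
  finally show ?thesis by simp
qed

lemma h_g_decomposition:
  assumes F: "monic_mat_poly q n F" and n: "1 \<le> n"
  shows "F = map_mat (\<lambda>p. p \<circ>\<^sub>p [:0, 0, 1:]) (h_part q n F) +
             [:0, 1:] \<cdot>\<^sub>m map_mat (\<lambda>p. p \<circ>\<^sub>p [:0, 0, 1:]) (g_part q n F)"
    (is "F = ?R")
proof (rule eq_matI)
  have Fc: "F \<in> carrier_mat q q" using F by (simp add: monic_mat_poly_def)
  fix r s assume "r < dim_row ?R" "s < dim_col ?R"
  then have rs: "r < q" "s < q" by (auto simp: g_part_def mat_poly_def split: if_splits)
  have dims: "h_part q n F \<in> carrier_mat q q" "g_part q n F \<in> carrier_mat q q"
    by (auto simp: h_part_def g_part_def mat_poly_def)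
  have z: "coeff (F $$ (r, s)) k = 0" if "k > n" for k
  proof -
    have "coeff_mat F k $$ (r, s) = 0" using F that rs by (simp add: monic_mat_poly_def)
    then show ?thesis using Fc rs by (simp add: coeff_mat_def)
  qed
  have A: "mp_coeff n F j $$ (r, s) = coeff (F $$ (r, s)) (n - j)" for j
    using Fc rs by (simp add: mp_coeff_def coeff_mat_def)
  have h: "coeff (h_part q n F $$ (r, s)) k = coeff (F $$ (r, s)) (2 * k)" for k
  proof (cases "even n")
    case True
    then obtain m where "n = 2 * m" by auto
    then show ?thesis using rs z A by (auto simp: h_part_def coeff_mat_poly diff_mult_distrib2)
  next
    case False
    then obtain m where "n = 2 * m + 1" by (rule oddE)
    then show ?thesis using rs z A by (auto simp: h_part_def coeff_mat_poly diff_mult_distrib2)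
  qed
  have g: "coeff (g_part q n F $$ (r, s)) k = coeff (F $$ (r, s)) (2 * k + 1)" for k
  proof (cases "even n")
    case True
    then obtain m where m: "n = 2 * m" by auto
    then have e: "2 * m - Suc (2 * (m - Suc k)) = Suc (2 * k)" if "k \<le> m - Suc 0"
      using that n by auto
    show ?thesis using m rs z n A by (auto simp: g_part_def coeff_mat_poly e)
  next
    case False
    then obtain m where m: "n = 2 * m + 1" by (rule oddE)
    then have e: "Suc (2 * m) - 2 * (m - k) = Suc (2 * k)" if "k \<le> m"
      using that by auto
    show ?thesis using m rs z A by (auto simp: g_part_def coeff_mat_poly e)
  qed
  have sq: "coeff (p \<circ>\<^sub>p [:0, 0, 1:]) k = (if even k then coeff p (k div 2) else 0)"
    for p :: "complex poly" and k
  proof (induction p arbitrary: k)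
    case (pCons a p)
    show ?case
    proof (cases k)
      case (Suc l)
      show ?thesis by (cases l) (simp_all add: Suc pcompose_pCons pCons.IH)
    qed (simp add: pcompose_pCons)
  qed simp
  have "coeff (?R $$ (r, s)) k = coeff (F $$ (r, s)) k" for k
  proof (cases k)
    case 0
    then show ?thesis using dims rs h[of 0] by (simp add: poly_0_coeff_0)
  next
    case (Suc l)
    then show ?thesis using dims rs by (auto simp: sq h g elim!: oddE)
  qed
  then show "F $$ (r, s) = ?R $$ (r, s)" by (simp add: poly_eq_iff)
qed (use F in \<open>auto simp: g_part_def mat_poly_def monic_mat_poly_def\<close>)

end

theory Submission
  imports Defs
begin

text \<open>
  A finite continued fraction is a quotient of continuants.  For \<open>n = 1, 2, 3, 4\<close>, unfolding \<open>K\<^sub>0\<close> from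
  the innermost floor outwards (\<open>continued_fraction_step\<close>) gives as numerator and denominator the parts
  \<open>g\<close> and \<open>h\<close> (for odd \<open>n\<close>, \<open>h\<close> and \<open>z g\<close>) of the matrix polynomials

  \<open>c\<^sub>0 z + 1\<close>,

  \<open>c\<^sub>0 d\<^sub>0 z\<^sup>2 + d\<^sub>0 z + 1\<close>,

  \<open>c\<^sub>0 d\<^sub>0 c\<^sub>1 z\<^sup>3 + d\<^sub>0 c\<^sub>1 z\<^sup>2 + (c\<^sub>0 + c\<^sub>1) z + 1\<close>,

  \<open>c\<^sub>0 d\<^sub>0 c\<^sub>1 d\<^sub>1 z\<^sup>4 + d\<^sub>0 c\<^sub>1 d\<^sub>1 z\<^sup>3 + (c\<^sub>0 (d\<^sub>0 + d\<^sub>1) + c\<^sub>1 d\<^sub>1) z\<^sup>2 + (d\<^sub>0 + d\<^sub>1) z + 1\<close>.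

  Since numerator and denominator of such a quotient are right coprime, a polynomial with the same
  quotient is the displayed one times a right factor \<open>S\<close>, and monicity forces \<open>S\<close> to be the inverse
  of the leading coefficient.  In degree at most three the coprimality takes at most one Euclidean
  division, carried out by hand (\<open>HTM_poly_1_coeffs\<close>, \<open>HTM_poly_2_coeffs\<close>, \<open>HTM_poly_3_coeffs\<close>).

  Positive definite matrices have positive determinant (\<open>det_herm_posdef_pos\<close>) and are closed under
  addition, so in degree at most three every coefficient is a product of matrices with positive
  determinant.  In degree four the coefficient of \<open>z\<^sup>2\<close> contains a sum of products of positive definite
  matrices, which need not have positive determinant; \<open>HTM_poly_4_negative_coeff_det\<close> chooses
  \<open>2 \<times> 2\<close> matrices for which it is negative.
\<close>

section \<open>Inverses and fractions of matrices over a field\<close>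

text \<open>
  Expansion rules for products of square matrices.  The dimension is kept as an explicit parameter:
  the rules have it only in their premises, so rewriting cannot find it by matching.
\<close>

lemmas square_mat_simps =
  assoc_mult_mat[of _ q q _ q _ q] add_mult_distrib_mat[of _ q q _ _ q]
  mult_add_distrib_mat[of _ q q _ q] mult_smult_assoc_mat[of _ q q _ q]
  mult_smult_distrib[of _ q q _ q] add_smult_distrib_left_mat[of _ q q]
  mult_carrier_mat[of _ q q _ q] for q

lemma mat_inv_nonsingular:
  fixes M :: "'a :: field mat"
  assumes M: "M \<in> carrier_mat q q" and d: "det M \<noteq> 0"
  shows "mat_inv M \<in> carrier_mat q q" "M * mat_inv M = 1\<^sub>m q" "mat_inv M * M = 1\<^sub>m q"
proof -
  obtain N where N: "N \<in> carrier_mat q q" "M * N = 1\<^sub>m q" "N * M = 1\<^sub>m q"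
    using det_non_zero_imp_unit[OF M d, of "()"] by (auto simp: Units_def ring_mat_def)
  then have "mat_inv M = N" using mat_inv_eq[OF M] by simp
  with N show "mat_inv M \<in> carrier_mat q q" "M * mat_inv M = 1\<^sub>m q" "mat_inv M * M = 1\<^sub>m q"
    by simp_all
qed

lemma mat_inv_cancel:
  fixes M :: "'a :: field mat"
  assumes M: "M \<in> carrier_mat q q" and d: "det M \<noteq> 0" and X: "X \<in> carrier_mat q q"
  shows "M * (mat_inv M * X) = X" "mat_inv M * (M * X) = X"
proof -
  note i = mat_inv_nonsingular[OF M d]
  show "M * (mat_inv M * X) = X"
    using assoc_mult_mat[OF M i(1) X] i(2) X by simp
  show "mat_inv M * (M * X) = X"
    using assoc_mult_mat[OF i(1) M X] i(3) X by simp
qed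

lemma mat_inv_mult_mat_inv:
  fixes A B :: "'a :: field mat"
  assumes A: "A \<in> carrier_mat q q" "det A \<noteq> 0" and B: "B \<in> carrier_mat q q" "det B \<noteq> 0"
  shows "mat_inv (A * mat_inv B) = B * mat_inv A"
proof (rule mat_inv_eq)
  note iA = mat_inv_nonsingular[OF A] and iB = mat_inv_nonsingular[OF B]
  show "A * mat_inv B * (B * mat_inv A) = 1\<^sub>m q"
    using A B iA(1,2) iB(1) mat_inv_cancel(2)[OF B iA(1)]
    by (simp add: assoc_mult_mat[of _ q q _ q _ q] mult_carrier_mat[of _ q q _ q])
  show "A * mat_inv B \<in> carrier_mat q q" "B * mat_inv A \<in> carrier_mat q q"
    using A B iA(1) iB(1) by auto
qed

text \<open>
  With \<open>K\<close> written as \<open>A B\<^sup>-\<^sup>1\<close>, one floor of the continued fraction is a step of the recursion for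
  its continuants: \<open>D + A B\<^sup>-\<^sup>1 = G B\<^sup>-\<^sup>1\<close>, and inverting exchanges numerator and denominator,
  so that \<open>C + B G\<^sup>-\<^sup>1 = H G\<^sup>-\<^sup>1\<close>.
\<close>

lemma continued_fraction_step:
  fixes A B C D G H :: "'a :: field mat"
  assumes A: "A \<in> carrier_mat q q" and B: "B \<in> carrier_mat q q"
    and C: "C \<in> carrier_mat q q" and D: "D \<in> carrier_mat q q"
    and G: "G = D * B + A" and H: "H = C * G + B"
    and det: "det B \<noteq> 0" "det G \<noteq> 0" "det H \<noteq> 0"
  shows "mat_inv (C + mat_inv (D + A * mat_inv B)) = G * mat_inv H"
proof -
  have Gc: "G \<in> carrier_mat q q" and Hc: "H \<in> carrier_mat q q"
    using A B C D G H by auto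
  note iB = mat_inv_nonsingular[OF B det(1)] and iG = mat_inv_nonsingular[OF Gc det(2)]
  have "G * mat_inv B = D * (B * mat_inv B) + A * mat_inv B"
    unfolding G using A B D iB(1)
    by (simp add: add_mult_distrib_mat[of _ q q _ _ q] assoc_mult_mat[of _ q q _ q _ q])
  then have 1: "D + A * mat_inv B = G * mat_inv B" using iB(2) D by simp
  have "H * mat_inv G = C * (G * mat_inv G) + B * mat_inv G"
    unfolding H using B C Gc iG(1)
    by (simp add: add_mult_distrib_mat[of _ q q _ _ q] assoc_mult_mat[of _ q q _ q _ q])
  then have 2: "C + B * mat_inv G = H * mat_inv G" using iG(2) C by simp
  show ?thesis
    unfolding 1 mat_inv_mult_mat_inv[OF Gc det(2) B det(1)] 2
    by (rule mat_inv_mult_mat_inv[OF Hc det(3) Gc det(2)])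
qed

text \<open>
  Multiplying the equation by \<open>Q\<close> from the right shows that \<open>S = H\<^sup>-\<^sup>1 Q\<close> works.  In the
  application \<open>G H\<^sup>-\<^sup>1\<close> is the value of the continued fraction, \<open>P\<close> and \<open>Q\<close> come from the odd and
  even parts of the polynomial, and the factor \<open>S\<close> will turn out to be a constant matrix.
\<close>

lemma right_fraction_eqD:
  fixes P Q G H :: "'a :: field mat"
  assumes P: "P \<in> carrier_mat q q" and Q: "Q \<in> carrier_mat q q" "det Q \<noteq> 0"
    and G: "G \<in> carrier_mat q q" and H: "H \<in> carrier_mat q q" "det H \<noteq> 0"
    and eq: "P * mat_inv Q = G * mat_inv H"
  obtains S where "S \<in> carrier_mat q q" "P = G * S" "Q = H * S"
proof
  note iQ = mat_inv_nonsingular[OF Q] and iH = mat_inv_nonsingular[OF H]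
  show "mat_inv H * Q \<in> carrier_mat q q" using iH Q by simp
  have "P = P * mat_inv Q * Q" using P Q iQ by (simp add: assoc_mult_mat[of _ q q _ q _ q])
  then show "P = G * (mat_inv H * Q)"
    unfolding eq using G Q iH by (simp add: assoc_mult_mat[of _ q q _ q _ q])
  show "Q = H * (mat_inv H * Q)" using mat_inv_cancel(1)[OF H Q(1)] ..
qed

lemma right_fraction_cancel:
  fixes G H S :: "'a :: field mat"
  assumes G: "G \<in> carrier_mat q q" and H: "H \<in> carrier_mat q q" "det H \<noteq> 0"
    and S: "S \<in> carrier_mat q q" "det S \<noteq> 0"
  shows "G * S * mat_inv (H * S) = G * mat_inv H"
proof -
  note iS = mat_inv_nonsingular[OF S] and iH = mat_inv_nonsingular[OF H]
  have "mat_inv (H * S) = mat_inv S * mat_inv H"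
    using H S iS(1) iH(1,2) mat_inv_cancel(1)[OF S iH(1)]
    by (intro mat_inv_eq)
       (auto simp: assoc_mult_mat[of _ q q _ q _ q] mult_carrier_mat[of _ q q _ q])
  then show ?thesis
    using G H S iS iH mat_inv_cancel(1)[OF S iH(1)]
    by (simp add: assoc_mult_mat[of _ q q _ q _ q] mult_carrier_mat[of _ q q _ q])
qed

section \<open>Matrix polynomials inside the rational matrix functions\<close>

interpretation to_fract_hom: comm_ring_hom "to_fract :: complex poly \<Rightarrow> _"
  by unfold_locales simp_all

interpretation const_hom: comm_ring_hom "\<lambda>a. to_fract [:a:] :: complex poly fract"
  by unfold_locales (simp_all flip: to_fract_add to_fract_mult one_pCons)

lemma const_ratmat_carrier [simp]: "const_ratmat A \<in> carrier_mat n m \<longleftrightarrow> A \<in> carrier_mat n m"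
  by (simp add: const_ratmat_def)

lemma dim_const_ratmat [simp]:
  "dim_row (const_ratmat A) = dim_row A" "dim_col (const_ratmat A) = dim_col A"
  by (simp_all add: const_ratmat_def)

lemma const_ratmat_mult:
  assumes "A \<in> carrier_mat q q" "B \<in> carrier_mat q q"
  shows "const_ratmat (A * B) = const_ratmat A * const_ratmat B"
  unfolding const_ratmat_def using assms by (rule const_hom.mat_hom_mult)

lemma const_ratmat_one: "const_ratmat (1\<^sub>m q) = 1\<^sub>m q"
  unfolding const_ratmat_def by (rule const_hom.mat_hom_one)

lemma const_ratmat_zero: "const_ratmat (0\<^sub>m q q) = 0\<^sub>m q q"
  by (auto simp: const_ratmat_def)

lemma const_ratmat_add:
  assumes "A \<in> carrier_mat q q" "B \<in> carrier_mat q q"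
  shows "const_ratmat (A + B) = const_ratmat A + const_ratmat B"
  using assms by (auto simp: const_ratmat_def simp flip: to_fract_add)

lemmas const_ratmat_simps = const_ratmat_add[of _ q] const_ratmat_mult[of _ q] const_ratmat_one for q

lemma det_const_ratmat: "det (const_ratmat A) = to_fract [:det A:]"
  unfolding const_ratmat_def by (rule const_hom.hom_det)

lemma const_ratmat_mat_inv:
  assumes A: "A \<in> carrier_mat q q" and d: "det A \<noteq> 0"
  shows "const_ratmat (mat_inv A) = mat_inv (const_ratmat A)"
proof (rule mat_inv_eq[symmetric, of _ q])
  note i = mat_inv_nonsingular[OF A d]
  show "const_ratmat A * const_ratmat (mat_inv A) = 1\<^sub>m q"
    using const_ratmat_mult[OF A i(1)] i(2) by (simp add: const_ratmat_one)
qed (use A mat_inv_nonsingular[OF A d] in auto)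

lemma mat_poly_carrier [simp]: "mat_poly q d B \<in> carrier_mat q q"
  by (simp add: mat_poly_def)

lemma dim_mat_poly [simp]: "dim_row (mat_poly q d B) = q" "dim_col (mat_poly q d B) = q"
  by (simp_all add: mat_poly_def)

lemma ratmat_carrier [simp]: "ratmat P \<in> carrier_mat n m \<longleftrightarrow> P \<in> carrier_mat n m"
  by (simp add: ratmat_def)

lemma ratmat_mat_poly_0:
  assumes "B 0 \<in> carrier_mat q q"
  shows "ratmat (mat_poly q 0 B) = const_ratmat (B 0)"
  using assms by (auto simp: ratmat_def const_ratmat_def mat_poly_def monom_0)

text \<open>Horner's scheme, which gives the explicit forms in low degree.\<close>

lemma ratmat_mat_poly_Suc:
  assumes B: "B (Suc d) \<in> carrier_mat q q"
  shows "ratmat (mat_poly q (Suc d) B)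
       = ratvar \<cdot>\<^sub>m ratmat (mat_poly q d B) + const_ratmat (B (Suc d))" (is "?L = ?R")
proof (rule eq_matI)
  fix r s assume "r < dim_row ?R" "s < dim_col ?R"
  then have rs: "r < q" "s < q" using B by (auto simp: const_ratmat_def)
  have "mat_poly q (Suc d) B $$ (r, s) = [:0, 1:] * mat_poly q d B $$ (r, s) + [:B (Suc d) $$ (r, s):]"
    by (rule poly_eqI) (auto simp: coeff_mat_poly[OF rs] coeff_pCons Suc_diff_le split: nat.splits)
  then show "?L $$ (r, s) = ?R $$ (r, s)"
    using rs B by (simp add: ratmat_def const_ratmat_def ratvar_def flip: to_fract_mult to_fract_add)
qed (use B in \<open>auto simp: const_ratmat_def ratmat_def\<close>)

lemma ratmat_mat_poly_inject:
  assumes B: "\<And>k. k \<le> d \<Longrightarrow> B k \<in> carrier_mat q q" and B': "\<And>k. k \<le> d \<Longrightarrow> B' k \<in> carrier_mat q q"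
    and eq: "ratmat (mat_poly q d B) = ratmat (mat_poly q d B')" and k: "k \<le> d"
  shows "B k = B' k"
proof (rule eq_matI)
  fix r s assume "r < dim_row (B' k)" "s < dim_col (B' k)"
  then have rs: "r < q" "s < q" using B'[OF k] by auto
  have "ratmat (mat_poly q d B) $$ (r, s) = ratmat (mat_poly q d B') $$ (r, s)" using eq by simp
  then have "mat_poly q d B $$ (r, s) = mat_poly q d B' $$ (r, s)"
    using rs by (simp add: ratmat_def)
  then have "coeff (mat_poly q d B $$ (r, s)) (d - k) = coeff (mat_poly q d B' $$ (r, s)) (d - k)"
    by simp
  then show "B k $$ (r, s) = B' k $$ (r, s)" using k by (simp add: coeff_mat_poly[OF rs])
qed (use B[OF k] B'[OF k] in auto)

lemma ratmat_mat_poly_linear: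
  assumes "a \<in> carrier_mat q q" "b \<in> carrier_mat q q"
  shows "ratmat (mat_poly q 1 (nth [a, b])) = ratvar \<cdot>\<^sub>m const_ratmat a + const_ratmat b"
  using assms by (simp add: ratmat_mat_poly_Suc ratmat_mat_poly_0)

lemma ratmat_mat_poly_quadratic:
  assumes "a \<in> carrier_mat q q" "b \<in> carrier_mat q q" "c \<in> carrier_mat q q"
  shows "ratmat (mat_poly q 2 (nth [a, b, c]))
       = ratvar \<cdot>\<^sub>m (ratvar \<cdot>\<^sub>m const_ratmat a + const_ratmat b) + const_ratmat c"
  using assms by (simp add: ratmat_mat_poly_Suc ratmat_mat_poly_0 numeral_2_eq_2)

lemma linear_coeffs_eq:
  assumes "a \<in> carrier_mat q q" "b \<in> carrier_mat q q" "a' \<in> carrier_mat q q" "b' \<in> carrier_mat q q"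
    and "ratvar \<cdot>\<^sub>m const_ratmat a + const_ratmat b = ratvar \<cdot>\<^sub>m const_ratmat a' + const_ratmat b'"
  shows "a = a'" "b = b'"
proof -
  have c: "[a, b] ! k \<in> carrier_mat q q" "[a', b'] ! k \<in> carrier_mat q q" if "k \<le> 1" for k
    using that assms by (cases k; auto)+
  have "ratmat (mat_poly q 1 (nth [a, b])) = ratmat (mat_poly q 1 (nth [a', b']))"
    using assms by (simp only: ratmat_mat_poly_linear)
  from ratmat_mat_poly_inject[OF c this] show "a = a'" "b = b'" by force+
qed

lemma quadratic_coeffs_eq:
  assumes "a \<in> carrier_mat q q" "b \<in> carrier_mat q q" "c \<in> carrier_mat q q"
    and "a' \<in> carrier_mat q q" "b' \<in> carrier_mat q q" "c' \<in> carrier_mat q q"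
    and "ratvar \<cdot>\<^sub>m (ratvar \<cdot>\<^sub>m const_ratmat a + const_ratmat b) + const_ratmat c
       = ratvar \<cdot>\<^sub>m (ratvar \<cdot>\<^sub>m const_ratmat a' + const_ratmat b') + const_ratmat c'"
  shows "a = a'" "b = b'" "c = c'"
proof -
  have c: "[a, b, c] ! k \<in> carrier_mat q q" "[a', b', c'] ! k \<in> carrier_mat q q" if "k \<le> 2" for k
    using that assms by (auto simp: nth_Cons' le_Suc_eq numeral_2_eq_2)
  have "ratmat (mat_poly q 2 (nth [a, b, c])) = ratmat (mat_poly q 2 (nth [a', b', c']))"
    using assms by (simp only: ratmat_mat_poly_quadratic)
  note inj = ratmat_mat_poly_inject[OF c this]
  show "a = a'" using inj[of 0] by simp
  show "b = b'" using inj[of 1] by simp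
  show "c = c'" using inj[of 2] by simp
qed

lemma det_ratmat: "det (ratmat P) = to_fract (det P)"
  unfolding ratmat_def by (rule to_fract_hom.hom_det)

text \<open>
  Evaluation at \<open>0\<close> commutes with the determinant, so an invertible constant term \<open>B d\<close> already
  makes the determinant a nonzero polynomial.
\<close>

lemma det_ratmat_mat_poly_nonzero:
  assumes B: "B d \<in> carrier_mat q q" and d: "det (B d) \<noteq> 0"
  shows "det (ratmat (mat_poly q d B)) \<noteq> 0"
proof -
  have eval: "comm_ring_hom (\<lambda>p :: complex poly. poly p 0)" by unfold_locales simp_all
  have "map_mat (\<lambda>p. poly p 0) (mat_poly q d B) = B d"
    using B by (intro eq_matI) (auto simp: poly_0_coeff_0 coeff_mat_poly)
  then have "poly (det (mat_poly q d B)) 0 = det (B d)"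
    using comm_ring_hom.hom_det[OF eval, of "mat_poly q d B"] by simp
  then show ?thesis using d by (auto simp: det_ratmat)
qed

lemma det_linear_nonzero:
  assumes "a \<in> carrier_mat q q" "b \<in> carrier_mat q q" "det b \<noteq> 0"
  shows "det (ratvar \<cdot>\<^sub>m const_ratmat a + const_ratmat b) \<noteq> 0"
  using det_ratmat_mat_poly_nonzero[of "nth [a, b]" 1 q] assms
  unfolding ratmat_mat_poly_linear[OF assms(1,2)] by simp

lemma det_quadratic_nonzero:
  assumes "a \<in> carrier_mat q q" "b \<in> carrier_mat q q" "c \<in> carrier_mat q q" "det c \<noteq> 0"
  shows "det (ratvar \<cdot>\<^sub>m (ratvar \<cdot>\<^sub>m const_ratmat a + const_ratmat b) + const_ratmat c) \<noteq> 0"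
  using det_ratmat_mat_poly_nonzero[of "nth [a, b, c]" 2 q] assms
  unfolding ratmat_mat_poly_quadratic[OF assms(1,2,3)] by simp

text \<open>
  Here the constant term may be singular; up to the embedding into rational functions the
  determinant is the characteristic polynomial of \<open>- A\<close>, which is monic.
\<close>

lemma det_monic_linear_nonzero:
  assumes A: "A \<in> carrier_mat q q"
  shows "det (ratvar \<cdot>\<^sub>m 1\<^sub>m q + const_ratmat A) \<noteq> 0"
proof -
  have "ratvar \<cdot>\<^sub>m 1\<^sub>m q + const_ratmat A = ratmat (char_poly_matrix (- A))"
    using A by (intro eq_matI)
      (auto simp: ratmat_def char_poly_matrix_def const_ratmat_def ratvar_def
            simp flip: to_fract_mult to_fract_add)
  moreover have "char_poly (- A) \<noteq> 0"
    using degree_monic_char_poly[of "- A" q] A by auto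
  ultimately show ?thesis by (simp add: det_ratmat char_poly_def)
qed

section \<open>Positive definite matrices\<close>

lemma complex_mult_pos:
  fixes x y :: complex
  assumes "0 < x" "0 < y"
  shows "0 < x * y"
  using assms by (auto simp: less_complex_def)

lemma complex_pos_right_factor:
  fixes x y :: complex
  assumes "0 < x" "x * y = 1"
  shows "0 < y"
proof -
  have "y = complex_of_real (1 / Re x)"
    using assms by (simp add: less_complex_def complex_eq_iff field_simps)
  then show ?thesis using assms(1) by (simp add: less_complex_def)
qed

lemma herm_posdef_carrier: "herm_posdef q M \<Longrightarrow> M \<in> carrier_mat q q"
  by (simp add: herm_posdef_def)

text \<open>
  The determinant is the product of the eigenvalues, each of which is a positive real number because
  \<open>(M v) \<bullet>c v = \<lambda> (v \<bullet>c v)\<close> for an eigenvector \<open>v\<close>.  The proof uses the characteristic polynomial of \<open>- M\<close>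
  instead of that of \<open>M\<close>, since its value at \<open>0\<close> is \<open>det M\<close> without a sign.
\<close>

lemma det_herm_posdef_pos:
  assumes M: "herm_posdef q M"
  shows "0 < det M"
proof -
  have Mc: "M \<in> carrier_mat q q" using M by (rule herm_posdef_carrier)
  then have nM: "- M \<in> carrier_mat q q" by simp
  obtain as where as: "char_poly (- M) = (\<Prod>a\<leftarrow>as. [:- a, 1:])"
    using char_poly_factorized[OF nM] by blast
  have pos: "0 < - a" if "a \<in> set as" for a
  proof -
    have "poly (char_poly (- M)) a = 0"
      unfolding as using that by (auto simp: poly_prod_list prod_list_zero_iff)
    then have "eigenvalue (- M) a" by (simp add: eigenvalue_root_char_poly[OF nM])
    then obtain v where v: "v \<in> carrier_vec q" "v \<noteq> 0\<^sub>v q" "- M *\<^sub>v v = a \<cdot>\<^sub>v v"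
      using nM by (auto simp: eigenvalue_def eigenvector_def)
    have "M *\<^sub>v v = (- a) \<cdot>\<^sub>v v"
    proof (rule eq_vecI)
      fix i assume "i < dim_vec (- a \<cdot>\<^sub>v v)"
      then have i: "i < q" using v by simp
      have "- (row M i \<bullet> v) = a * v $ i"
        using arg_cong[OF v(3), of "\<lambda>w. w $ i"] i Mc v(1) by simp
      then show "(M *\<^sub>v v) $ i = (- a \<cdot>\<^sub>v v) $ i"
        using i Mc v(1) by (simp add: minus_equation_iff)
    qed (use Mc v in auto)
    then have "0 < - a * (v \<bullet>c v)"
      using M v by (auto simp: herm_posdef_def)
    moreover have "0 < v \<bullet>c v" using v by simp
    ultimately show "0 < - a"
      by (auto simp: less_complex_def mult_less_0_iff)
  qed
  have "- char_matrix (- M) 0 = M"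
    using Mc by (intro eq_matI) (auto simp: char_matrix_def)
  then have "det M = poly (char_poly (- M)) 0" by (simp add: char_poly_matrix[OF nM])
  also have "\<dots> = (\<Prod>a\<leftarrow>as. - a)" unfolding as by (simp add: poly_prod_list o_def)
  also have "0 < \<dots>"
    using pos
  proof (induction as)
    case (Cons a as)
    then have "0 < - a * (\<Prod>a\<leftarrow>as. - a)" by (intro complex_mult_pos) auto
    then show ?case by simp
  qed (simp add: less_complex_def)
  finally show ?thesis .
qed

lemma herm_posdef_add:
  assumes M: "herm_posdef q M" and N: "herm_posdef q N"
  shows "herm_posdef q (M + N)"
proof -
  have c: "M \<in> carrier_mat q q" "N \<in> carrier_mat q q" using M N by (simp_all add: herm_posdef_carrier)
  have "mat_adjoint (M + N) = mat_adjoint M + mat_adjoint N"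
    using c by (intro eq_matI) (auto simp: mat_adjoint_def mat_of_rows_def)
  moreover have "0 < ((M + N) *\<^sub>v v) \<bullet>c v" if "v \<in> carrier_vec q" "v \<noteq> 0\<^sub>v q" for v
  proof -
    have "((M + N) *\<^sub>v v) \<bullet>c v = (M *\<^sub>v v) \<bullet>c v + (N *\<^sub>v v) \<bullet>c v"
      using c that by (simp add: add_mult_distrib_mat_vec[of _ q q] add_scalar_prod_distrib[of _ q])
    then show ?thesis using M N that by (auto simp: herm_posdef_def intro!: add_pos_pos)
  qed
  ultimately show ?thesis using M N by (simp add: herm_posdef_def)
qed

section \<open>Hurwitz-type polynomials of degree at most three\<close>

lemma HTM_poly_D:
  assumes "HTM_poly q n F"
  shows "monic_mat_poly q n F" "mp_coeff n F k \<in> carrier_mat q q" "mp_coeff n F 0 = 1\<^sub>m q"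
  using assms by (auto simp: HTM_poly_def monic_mat_poly_def mp_coeff_def coeff_mat_def)

text \<open>
  This lemma and the next two express the coefficients through the matrices of the continued
  fraction.  Apart from sums of two positive definite matrices, only products occur, with a common
  right factor \<open>S\<close> that inverts the leading coefficient of a continuant; in degree one \<open>S\<close> is \<open>A\<^sub>1\<close>.
\<close>

lemma HTM_poly_1_coeffs:
  assumes F: "HTM_poly q 1 F"
  obtains c\<^sub>0 where "herm_posdef q c\<^sub>0" "c\<^sub>0 * mp_coeff 1 F 1 = 1\<^sub>m q"
proof -
  let ?z = ratvar and ?C = const_ratmat
  define A where "A = mp_coeff 1 F"
  have A: "A k \<in> carrier_mat q q" "A 0 = 1\<^sub>m q" for k using HTM_poly_D[OF F] by (auto simp: A_def)
  obtain c where c0: "herm_posdef q (c 0)" 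
    and K: "?C (A 1) * mat_inv (?z \<cdot>\<^sub>m 1\<^sub>m q) = inverse ?z \<cdot>\<^sub>m ?C (mat_inv (c 0))"
    using F A by (auto simp: HTM_poly_def h_part_def g_part_def ratmat_mat_poly_0 const_ratmat_one K_odd.simps
        simp flip: A_def[unfolded One_nat_def])
  have cc: "c 0 \<in> carrier_mat q q" and dc: "det (c 0) \<noteq> 0"
    using herm_posdef_carrier[OF c0] det_herm_posdef_pos[OF c0] by auto
  note ic = mat_inv_nonsingular[OF cc dc]
  have z: "?z \<noteq> 0" by (simp add: ratvar_def)
  have "mat_inv (?z \<cdot>\<^sub>m 1\<^sub>m q) = inverse ?z \<cdot>\<^sub>m 1\<^sub>m q"
    by (rule mat_inv_eq[of _ q])
      (use z in \<open>auto simp: mult_smult_assoc_mat[of _ q q _ q] mult_smult_distrib[of _ q q _ q]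
        intro!: eq_matI\<close>)
  then have "inverse ?z \<cdot>\<^sub>m ?C (A 1) = inverse ?z \<cdot>\<^sub>m ?C (mat_inv (c 0))"
    using K A(1)[of 1] by (simp add: mult_smult_distrib[of _ q q _ q])
  then have "?C (A 1) = ?C (mat_inv (c 0))"
    using z by (auto simp: mat_eq_iff)
  then have "A 1 = mat_inv (c 0)"
    by (auto simp: const_ratmat_def mat_eq_iff)
  then show thesis using that[OF c0] ic by (simp add: A_def)
qed

lemma HTM_poly_2_coeffs:
  assumes F: "HTM_poly q 2 F"
  obtains c\<^sub>0 d\<^sub>0 S where "herm_posdef q c\<^sub>0" "herm_posdef q d\<^sub>0" "S \<in> carrier_mat q q"
    "c\<^sub>0 * (d\<^sub>0 * S) = 1\<^sub>m q" "mp_coeff 2 F 1 = d\<^sub>0 * S" "mp_coeff 2 F 2 = S"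
proof -
  let ?z = ratvar and ?C = const_ratmat
  define A where "A = mp_coeff 2 F"
  have A: "A k \<in> carrier_mat q q" "A 0 = 1\<^sub>m q" for k using HTM_poly_D[OF F] by (auto simp: A_def)
  obtain c d where c0: "herm_posdef q (c 0)" and d0: "herm_posdef q (d 0)"
    and K: "ratmat (mat_poly q 0 (\<lambda>k. A (2 * k + 1))) * mat_inv (ratmat (mat_poly q 1 (\<lambda>k. A (2 * k))))
         = K_even c d 1 0"
    using F by (auto simp: HTM_poly_def h_part_def g_part_def simp flip: A_def)
  have cc: "c 0 \<in> carrier_mat q q" "d 0 \<in> carrier_mat q q"
    and dd: "det (d 0) \<noteq> 0"
    using herm_posdef_carrier[OF c0] herm_posdef_carrier[OF d0] det_herm_posdef_pos[OF d0] by auto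
  note id = mat_inv_nonsingular[OF cc(2) dd]
  (* The fraction for K_0; its innermost floor is the general step with A = 0 and B = 1. *)
  define H where "H = ?z \<cdot>\<^sub>m ?C (c 0 * d 0) + ?C (1\<^sub>m q)"
  have Hc: "H \<in> carrier_mat q q" and dH: "det H \<noteq> 0"
    using cc det_linear_nonzero[of "c 0 * d 0" q "1\<^sub>m q"] by (auto simp: H_def)
  have dC: "det (?C (d 0)) \<noteq> 0" using dd by (simp add: det_const_ratmat)
  have "K_even c d 1 0 = mat_inv (?z \<cdot>\<^sub>m ?C (c 0) + mat_inv (?C (d 0) + 0\<^sub>m q q * mat_inv (1\<^sub>m q)))"
    using cc dd by (simp add: K_even.simps const_ratmat_mat_inv mat_inv_eq[of "1\<^sub>m q" q "1\<^sub>m q"])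
  also have "\<dots> = ?C (d 0) * mat_inv H"
    by (rule continued_fraction_step)
      (use cc dC dH in \<open>auto simp: H_def const_ratmat_mult const_ratmat_one mult_smult_assoc_mat[of _ q q _ q]\<close>)
  finally have K': "?C (A 1) * mat_inv (?z \<cdot>\<^sub>m 1\<^sub>m q + ?C (A 2)) = ?C (d 0) * mat_inv H"
    using K A by (simp add: ratmat_mat_poly_0 ratmat_mat_poly_Suc const_ratmat_one)
  obtain S where S: "S \<in> carrier_mat q q" "?C (A 1) = ?C (d 0) * S" "?z \<cdot>\<^sub>m 1\<^sub>m q + ?C (A 2) = H * S"
    by (rule right_fraction_eqD[OF _ _ _ _ Hc dH K']) (use A cc det_monic_linear_nonzero in auto)
  (* S is a constant matrix, as d_0 S is the constant A_1. *)
  define s where "s = mat_inv (d 0) * A 1"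
  have sc: "s \<in> carrier_mat q q" and ds: "d 0 * s = A 1"
    using id A cc dd by (auto simp: s_def mat_inv_cancel)
  have "S = mat_inv (?C (d 0)) * ?C (A 1)"
    unfolding S(2) using mat_inv_cancel(2)[OF _ dC S(1)] cc by simp
  then have Ss: "S = ?C s" using A id cc dd by (simp add: s_def const_ratmat_mult const_ratmat_mat_inv)
  have "?z \<cdot>\<^sub>m ?C (1\<^sub>m q) + ?C (A 2) = ?z \<cdot>\<^sub>m ?C (c 0 * (d 0 * s)) + ?C s"
    using S(3) cc sc unfolding H_def Ss
    by (simp add: const_ratmat_mult const_ratmat_one add_mult_distrib_mat[of _ q q _ _ q]
        mult_smult_assoc_mat[of _ q q _ q] assoc_mult_mat[of _ q q _ q _ q] mult_carrier_mat[of _ q q _ q])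
  note eq = this
  have "1\<^sub>m q = c 0 * (d 0 * s)" "A 2 = s"
    by (rule linear_coeffs_eq[of _ q, OF _ _ _ _ eq]; use A(1)[of 2] cc sc in auto)+
  then show thesis using that[OF c0 d0 sc] ds by (simp add: A_def)
qed

lemma HTM_poly_3_coeffs:
  assumes F: "HTM_poly q 3 F"
  obtains c\<^sub>0 c\<^sub>1 d\<^sub>0 S where
    "herm_posdef q c\<^sub>0" "herm_posdef q c\<^sub>1" "herm_posdef q d\<^sub>0" "S \<in> carrier_mat q q"
    "c\<^sub>0 * (d\<^sub>0 * (c\<^sub>1 * S)) = 1\<^sub>m q" "mp_coeff 3 F 1 = d\<^sub>0 * (c\<^sub>1 * S)"
    "mp_coeff 3 F 2 = (c\<^sub>0 + c\<^sub>1) * S" "mp_coeff 3 F 3 = S"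
proof -
  let ?z = ratvar and ?C = const_ratmat
  define A where "A = mp_coeff 3 F"
  have A: "A k \<in> carrier_mat q q" "A 0 = 1\<^sub>m q" for k using HTM_poly_D[OF F] by (auto simp: A_def)
  obtain c d where c: "herm_posdef q (c 0)" "herm_posdef q (c 1)" and d: "herm_posdef q (d 0)"
    and K: "ratmat (mat_poly q 1 (\<lambda>k. A (2 * k + 1)))
              * mat_inv (?z \<cdot>\<^sub>m ratmat (mat_poly q 1 (\<lambda>k. A (2 * k)))) = K_odd c d 1 0"
    using F by (auto simp: HTM_poly_def h_part_def g_part_def simp flip: A_def)
  define c\<^sub>0 c\<^sub>1 d\<^sub>0 where "c\<^sub>0 = c 0" "c\<^sub>1 = c 1" "d\<^sub>0 = d 0"
  note defs = this
  have pd: "herm_posdef q c\<^sub>0" "herm_posdef q c\<^sub>1" "herm_posdef q d\<^sub>0" using c d by (auto simp: defs)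
  have cc: "c\<^sub>0 \<in> carrier_mat q q" "c\<^sub>1 \<in> carrier_mat q q" "d\<^sub>0 \<in> carrier_mat q q"
    using pd by (auto simp: herm_posdef_carrier)
  have det: "det c\<^sub>1 \<noteq> 0" "det d\<^sub>0 \<noteq> 0" "det (c\<^sub>0 + c\<^sub>1) \<noteq> 0"
    using det_herm_posdef_pos pd herm_posdef_add[OF pd(1,2)] by fastforce+
  have z: "?z \<noteq> 0" by (simp add: ratvar_def)
  note sm = square_mat_simps[where q = q] and cs = const_ratmat_simps[where q = q]
  have ic: "mat_inv c\<^sub>1 \<in> carrier_mat q q" "c\<^sub>1 * mat_inv c\<^sub>1 = 1\<^sub>m q"
    using mat_inv_nonsingular[OF cc(2) det(1)] by auto
  have dC: "det (?C c\<^sub>1) \<noteq> 0" using det by (simp add: det_const_ratmat)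

  (* K_1 = 1 B^-1, and one step of the continuant recursion gives K_0 = G (z H)^-1. *)
  define B where "B = ?z \<cdot>\<^sub>m ?C c\<^sub>1"
  define G where "G = ?z \<cdot>\<^sub>m ?C (d\<^sub>0 * c\<^sub>1) + ?C (1\<^sub>m q)"
  define H where "H = ?z \<cdot>\<^sub>m ?C (c\<^sub>0 * (d\<^sub>0 * c\<^sub>1)) + ?C (c\<^sub>0 + c\<^sub>1)"
  have Bc: "B \<in> carrier_mat q q" "det B \<noteq> 0" using cc z dC by (auto simp: B_def)
  have Gc: "G \<in> carrier_mat q q" and dG: "det G \<noteq> 0"
    using cc det_linear_nonzero[of "d\<^sub>0 * c\<^sub>1" q "1\<^sub>m q"] by (auto simp: G_def)
  have Hc: "H \<in> carrier_mat q q" and dH: "det H \<noteq> 0"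
    using cc det det_linear_nonzero[of "c\<^sub>0 * (d\<^sub>0 * c\<^sub>1)" q "c\<^sub>0 + c\<^sub>1"] by (auto simp: H_def)
  have dzH: "det (?z \<cdot>\<^sub>m H) \<noteq> 0" using dH z by simp
  have "mat_inv B = inverse ?z \<cdot>\<^sub>m ?C (mat_inv c\<^sub>1)"
    using Bc cc ic z const_ratmat_mult[OF cc(2) ic(1)]
    by (intro mat_inv_eq[of _ q])
      (auto simp: B_def sm cs intro!: eq_matI)
  then have "K_odd c d 1 0 = mat_inv (?z \<cdot>\<^sub>m ?C c\<^sub>0 + mat_inv (?C d\<^sub>0 + 1\<^sub>m q * mat_inv B))"
    using ic by (simp add: K_odd.simps[of c d "Suc 0" 0] K_odd.simps[of c d "Suc 0" "Suc 0"] defs)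
  also have "\<dots> = G * mat_inv (?z \<cdot>\<^sub>m H)"
  proof (rule continued_fraction_step)
    show "G = ?C d\<^sub>0 * B + 1\<^sub>m q"
      using cc by (simp add: G_def B_def sm cs)
    show "?z \<cdot>\<^sub>m H = ?z \<cdot>\<^sub>m ?C c\<^sub>0 * G + B"
      using cc by (simp add: G_def H_def B_def sm cs assoc_add_mat[of _ q q])
  qed (use Bc Gc dG Hc dzH cc in auto)
  finally have K': "(?z \<cdot>\<^sub>m ?C (A 1) + ?C (A 3)) * mat_inv (?z \<cdot>\<^sub>m (?z \<cdot>\<^sub>m ?C (1\<^sub>m q) + ?C (A 2)))
      = G * mat_inv (?z \<cdot>\<^sub>m H)"
    using K A by (simp add: ratmat_mat_poly_0 ratmat_mat_poly_Suc numeral_3_eq_3)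
  have dzg: "det (?z \<cdot>\<^sub>m (?z \<cdot>\<^sub>m ?C (1\<^sub>m q) + ?C (A 2))) \<noteq> 0"
    using z det_monic_linear_nonzero[OF A(1)[of 2]] by (simp add: const_ratmat_one)
  obtain S where S: "S \<in> carrier_mat q q" and h: "?z \<cdot>\<^sub>m ?C (A 1) + ?C (A 3) = G * S"
    and zg: "?z \<cdot>\<^sub>m (?z \<cdot>\<^sub>m ?C (1\<^sub>m q) + ?C (A 2)) = ?z \<cdot>\<^sub>m H * S"
    by (rule right_fraction_eqD[OF _ _ dzg Gc _ dzH K']) (use A Hc in auto)
  have "?z \<cdot>\<^sub>m H * S = ?z \<cdot>\<^sub>m (H * S)" using Hc S by (simp add: sm)
  then have g: "?z \<cdot>\<^sub>m ?C (1\<^sub>m q) + ?C (A 2) = H * S"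
    using zg z Hc S A by (auto simp: mat_eq_iff simp flip: distrib_left)

  (* One step of the Euclidean algorithm, H - c_0 G = c_1, shows that c_1 S = g - c_0 h has
     degree at most 1 in z; its coefficients are u and v. *)
  define u v where "u = 1\<^sub>m q - c\<^sub>0 * A 1" "v = A 2 - c\<^sub>0 * A 3"
  note uv = this
  have uvc: "u \<in> carrier_mat q q" "v \<in> carrier_mat q q" using A cc by (auto simp: uv intro!: minus_carrier_mat)
  have u: "1\<^sub>m q = c\<^sub>0 * A 1 + u" and v: "A 2 = c\<^sub>0 * A 3 + v"
    using A(1)[of 1] A(1)[of 2] A(1)[of 3] cc unfolding uv by (auto intro!: eq_matI)
  have "?C c\<^sub>0 * (G * S) + ?C c\<^sub>1 * S = H * S"
    using cc S Hc Gc unfolding G_def H_def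
    by (simp add: sm cs assoc_add_mat[of _ q q])
  also have "\<dots> = ?z \<cdot>\<^sub>m ?C (c\<^sub>0 * A 1 + u) + ?C (c\<^sub>0 * A 3 + v)"
    unfolding g[symmetric] using u v by simp
  also have "\<dots> = ?C c\<^sub>0 * (G * S) + (?z \<cdot>\<^sub>m ?C u + ?C v)"
    unfolding h[symmetric] using cc A uvc
    by (auto simp: sm cs carrier_matD[OF A(1)] intro!: eq_matI)
  finally have "?C c\<^sub>1 * S = ?z \<cdot>\<^sub>m ?C u + ?C v"
    using cc Gc S uvc by (auto simp: mat_eq_iff)
  moreover have "S = mat_inv (?C c\<^sub>1) * (?C c\<^sub>1 * S)"
    using mat_inv_cancel(2)[OF _ dC S] cc by simp
  ultimately have S': "S = mat_inv (?C c\<^sub>1) * (?z \<cdot>\<^sub>m ?C u + ?C v)" by simp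
  define s t where "s = mat_inv c\<^sub>1 * u" "t = mat_inv c\<^sub>1 * v"
  have stc: "s \<in> carrier_mat q q" "t \<in> carrier_mat q q" using ic uvc by (auto simp: s_t_def)
  have Sst: "S = ?z \<cdot>\<^sub>m ?C s + ?C t"
    unfolding S' const_ratmat_mat_inv[OF cc(2) det(1), symmetric]
    using ic uvc by (simp add: s_t_def sm cs)

  (* As h = G S has degree at most 1 and the leading coefficient ?p of G is invertible, the
     coefficient s of z in S vanishes. *)
  let ?p = "d\<^sub>0 * c\<^sub>1"
  have p: "?p \<in> carrier_mat q q" "det ?p \<noteq> 0" using cc det by (auto simp: det_mult[of _ q])
  have "?z \<cdot>\<^sub>m (?z \<cdot>\<^sub>m ?C (0\<^sub>m q q) + ?C (A 1)) + ?C (A 3) = G * S"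
    unfolding h[symmetric] using A by (auto simp: const_ratmat_zero)
  also have "\<dots> = ?z \<cdot>\<^sub>m (?z \<cdot>\<^sub>m ?C (?p * s) + ?C (?p * t + s)) + ?C t"
    unfolding G_def Sst using p stc
    by (auto simp: sm cs simp del: assoc_mult_mat intro!: eq_matI)
  finally have eq: "?z \<cdot>\<^sub>m (?z \<cdot>\<^sub>m ?C (0\<^sub>m q q) + ?C (A 1)) + ?C (A 3)
      = ?z \<cdot>\<^sub>m (?z \<cdot>\<^sub>m ?C (?p * s) + ?C (?p * t + s)) + ?C t" .
  have coeffs: "0\<^sub>m q q = ?p * s" "A 1 = ?p * t + s" "A 3 = t"
    by (rule quadratic_coeffs_eq[of _ q, OF _ _ _ _ _ _ eq]; use A(1)[of 1] A(1)[of 3] stc p in auto)+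
  have s0: "s = 0\<^sub>m q q"
    using mat_inv_cancel(2)[OF p stc(1)] mat_inv_nonsingular(1)[OF p] by (simp flip: coeffs(1))
  then have St: "S = ?C t" unfolding Sst using stc by (auto simp: const_ratmat_zero)
  have "?z \<cdot>\<^sub>m ?C (1\<^sub>m q) + ?C (A 2) = ?z \<cdot>\<^sub>m ?C (c\<^sub>0 * (d\<^sub>0 * (c\<^sub>1 * t))) + ?C ((c\<^sub>0 + c\<^sub>1) * t)"
    unfolding g St H_def using cc stc by (simp add: sm cs)
  note eq' = this
  have "1\<^sub>m q = c\<^sub>0 * (d\<^sub>0 * (c\<^sub>1 * t))" "A 2 = (c\<^sub>0 + c\<^sub>1) * t"
    by (rule linear_coeffs_eq[of _ q, OF _ _ _ _ eq']; use A(1)[of 2] cc stc in auto)+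
  then show thesis using that[OF pd stc(2)] coeffs(2,3) s0 cc stc by (simp add: A_def sm)
qed

text \<open>
  Up to degree three the only sum in the coefficient formulas is \<open>c\<^sub>0 + c\<^sub>1\<close>, which is again positive
  definite.  So every determinant is a product of positive numbers.
\<close>

lemma HTM_poly_upto_3_det_pos:
  assumes n: "n \<in> {1, 2, 3}" and F: "HTM_poly q n F" and j: "j \<le> n"
  shows "0 < det (mp_coeff n F j)"
proof -
  have 0: "0 < det (mp_coeff n F 0)" using HTM_poly_D(3)[OF F] by (simp add: less_complex_def)
  have mult: "det (M * N) = det M * det N" if "M \<in> carrier_mat q q" "N \<in> carrier_mat q q"
    for M N :: "complex mat" using that by (rule det_mult)
  consider "n = 1" | "n = 2" | "n = 3" using n by auto
  then show ?thesis
  proof cases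
    case 1
    with F obtain c\<^sub>0 where c: "herm_posdef q c\<^sub>0" "c\<^sub>0 * mp_coeff 1 F 1 = 1\<^sub>m q"
      using HTM_poly_1_coeffs by metis
    have "det c\<^sub>0 * det (mp_coeff 1 F 1) = 1"
      using mult[of c\<^sub>0 "mp_coeff 1 F 1"] c HTM_poly_D(2)[OF F] 1 by (simp add: herm_posdef_carrier)
    then have "0 < det (mp_coeff 1 F 1)"
      using complex_pos_right_factor det_herm_posdef_pos[OF c(1)] by blast
    then show ?thesis using 0 1 j by (auto simp: le_Suc_eq)
  next
    case 2
    obtain c\<^sub>0 d\<^sub>0 S where pd: "herm_posdef q c\<^sub>0" "herm_posdef q d\<^sub>0" and S: "S \<in> carrier_mat q q"
      and e: "c\<^sub>0 * (d\<^sub>0 * S) = 1\<^sub>m q" "mp_coeff 2 F 1 = d\<^sub>0 * S" "mp_coeff 2 F 2 = S"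
      using HTM_poly_2_coeffs[of q F] F 2 by metis
    note cc = pd[THEN herm_posdef_carrier] and pos = pd[THEN det_herm_posdef_pos]
    have "(det c\<^sub>0 * det d\<^sub>0) * det S = 1"
      using arg_cong[OF e(1), of det] cc S by (simp add: mult mult.assoc)
    then have "0 < det S" using complex_pos_right_factor complex_mult_pos pos by blast
    then show ?thesis using 0 2 j e(2,3) pos cc S
      by (auto simp: le_Suc_eq numeral_2_eq_2 mult complex_mult_pos)
  next
    case 3
    obtain c\<^sub>0 c\<^sub>1 d\<^sub>0 S where pd: "herm_posdef q c\<^sub>0" "herm_posdef q c\<^sub>1" "herm_posdef q d\<^sub>0"
      and S: "S \<in> carrier_mat q q" and e: "c\<^sub>0 * (d\<^sub>0 * (c\<^sub>1 * S)) = 1\<^sub>m q"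
        "mp_coeff 3 F 1 = d\<^sub>0 * (c\<^sub>1 * S)" "mp_coeff 3 F 2 = (c\<^sub>0 + c\<^sub>1) * S" "mp_coeff 3 F 3 = S"
      using HTM_poly_3_coeffs[of q F] F 3 by metis
    note cc = pd[THEN herm_posdef_carrier] and pos = pd[THEN det_herm_posdef_pos]
    have "(det c\<^sub>0 * (det d\<^sub>0 * det c\<^sub>1)) * det S = 1"
      using arg_cong[OF e(1), of det] cc S by (simp add: mult mult.assoc)
    then have "0 < det S" using complex_pos_right_factor complex_mult_pos pos by blast
    moreover have "0 < det (c\<^sub>0 + c\<^sub>1)" using herm_posdef_add[OF pd(1,2)] by (rule det_herm_posdef_pos)
    ultimately show ?thesis using 0 3 j e(2-) pos cc S
      by (auto simp: le_Suc_eq numeral_3_eq_3 numeral_2_eq_2 mult complex_mult_pos)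
  qed
qed

section \<open>Hurwitz-type polynomials of degree four\<close>

lemma mp_coeff_mat_poly:
  assumes "j \<le> n" "B j \<in> carrier_mat q q"
  shows "mp_coeff n (mat_poly q n B) j = B j"
  using assms by (intro eq_matI) (auto simp: mp_coeff_def coeff_mat_def coeff_mat_poly)

lemma monic_mat_poly_mat_poly:
  assumes "B 0 = 1\<^sub>m q"
  shows "monic_mat_poly q n (mat_poly q n B)"
  using assms unfolding monic_mat_poly_def
  by (auto simp: coeff_mat_def coeff_mat_poly intro!: eq_matI)

lemma mat_poly_cong:
  assumes "\<And>k. k \<le> d \<Longrightarrow> B k = B' k"
  shows "mat_poly q d B = mat_poly q d B'"
  using assms by (auto simp: mat_poly_def intro!: cong_mat)

text \<open>
  The same pattern in degree four, read in the converse direction: the continuants with any positive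
  definite parameters, multiplied by the constant \<open>S\<close> that makes the polynomial monic, form a
  Hurwitz-type polynomial.  The coefficient \<open>B 2\<close> contains the sum \<open>c\<^sub>0 (d\<^sub>0 + d\<^sub>1) + c\<^sub>1 d\<^sub>1\<close> of
  products, for which positivity of the determinant is no longer guaranteed.
\<close>

lemma HTM_poly_4I:
  assumes pd: "herm_posdef q c\<^sub>0" "herm_posdef q c\<^sub>1" "herm_posdef q d\<^sub>0" "herm_posdef q d\<^sub>1"
    and S: "S \<in> carrier_mat q q" "c\<^sub>0 * (d\<^sub>0 * (c\<^sub>1 * (d\<^sub>1 * S))) = 1\<^sub>m q"
    and B: "B 0 = 1\<^sub>m q" "B 1 = d\<^sub>0 * (c\<^sub>1 * (d\<^sub>1 * S))" "B 2 = (c\<^sub>0 * (d\<^sub>0 + d\<^sub>1) + c\<^sub>1 * d\<^sub>1) * S"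
      "B 3 = (d\<^sub>0 + d\<^sub>1) * S" "B 4 = S"
  shows "HTM_poly q 4 (mat_poly q 4 B)"
proof -
  let ?z = ratvar and ?C = const_ratmat
  let ?F = "mat_poly q 4 B"
  note cc = pd[THEN herm_posdef_carrier] and pos = pd[THEN det_herm_posdef_pos]
  note sm = square_mat_simps[where q = q] and cs = const_ratmat_simps[where q = q]
  have Bc: "B k \<in> carrier_mat q q" if "k \<in> {0, 1, 2, 3, 4}" for k
    using that B cc S(1) by (auto simp: sm)
  have coeff: "mp_coeff 4 ?F k = B k" if "k \<in> {0, 1, 2, 3, 4}" for k
    using that Bc[OF that] by (intro mp_coeff_mat_poly) auto
  have "g_part q 4 ?F = mat_poly q 1 (nth [B 1, B 3])"
    using coeff by (auto simp: g_part_def le_Suc_eq intro!: mat_poly_cong)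
  then have g: "ratmat (g_part q 4 ?F) = ?z \<cdot>\<^sub>m ?C (B 1) + ?C (B 3)"
    using Bc ratmat_mat_poly_linear[of "B 1" q "B 3"] by simp
  have "h_part q 4 ?F = mat_poly q 2 (\<lambda>k. mp_coeff 4 ?F (2 * k))"
    by (simp add: h_part_def)
  also have "\<dots> = mat_poly q 2 (nth [B 0, B 2, B 4])"
  proof (rule mat_poly_cong)
    fix k :: nat assume "k \<le> 2"
    then consider "k = 0" | "k = 1" | "k = 2" by linarith
    then show "mp_coeff 4 ?F (2 * k) = [B 0, B 2, B 4] ! k"
      by cases (use coeff[of 0] coeff[of 2] coeff[of 4] in auto)
  qed
  finally have h: "ratmat (h_part q 4 ?F) = ?z \<cdot>\<^sub>m (?z \<cdot>\<^sub>m ?C (B 0) + ?C (B 2)) + ?C (B 4)"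
    using Bc ratmat_mat_poly_quadratic[of "B 0" q "B 2" "B 4"] by simp

  define H\<^sub>1 where "H\<^sub>1 = ?z \<cdot>\<^sub>m ?C (c\<^sub>1 * d\<^sub>1) + ?C (1\<^sub>m q)"
  define G where "G = ?z \<cdot>\<^sub>m ?C (d\<^sub>0 * (c\<^sub>1 * d\<^sub>1)) + ?C (d\<^sub>0 + d\<^sub>1)"
  define H where "H = ?z \<cdot>\<^sub>m (?z \<cdot>\<^sub>m ?C (c\<^sub>0 * (d\<^sub>0 * (c\<^sub>1 * d\<^sub>1))) + ?C (c\<^sub>0 * (d\<^sub>0 + d\<^sub>1) + c\<^sub>1 * d\<^sub>1)) + ?C (1\<^sub>m q)"
  have det_d: "det (d\<^sub>0 + d\<^sub>1) \<noteq> 0"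
    using det_herm_posdef_pos[OF herm_posdef_add[OF pd(3,4)]] by auto
  have H1: "H\<^sub>1 \<in> carrier_mat q q" "det H\<^sub>1 \<noteq> 0"
    using cc det_linear_nonzero[of "c\<^sub>1 * d\<^sub>1" q "1\<^sub>m q"] by (auto simp: H\<^sub>1_def)
  have G: "G \<in> carrier_mat q q" "det G \<noteq> 0"
    using cc det_d det_linear_nonzero[of "d\<^sub>0 * (c\<^sub>1 * d\<^sub>1)" q "d\<^sub>0 + d\<^sub>1"] by (auto simp: G_def)
  have H: "H \<in> carrier_mat q q" "det H \<noteq> 0"
    using cc det_quadratic_nonzero[of "c\<^sub>0 * (d\<^sub>0 * (c\<^sub>1 * d\<^sub>1))" q "c\<^sub>0 * (d\<^sub>0 + d\<^sub>1) + c\<^sub>1 * d\<^sub>1" "1\<^sub>m q"]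
    by (auto simp: H_def)
  have dC: "det d\<^sub>1 \<noteq> 0" "det (?C d\<^sub>1) \<noteq> 0" using pos(4) by (auto simp: det_const_ratmat)
  have dS: "det (?C S) \<noteq> 0"
  proof -
    have "det c\<^sub>0 * det (d\<^sub>0 * (c\<^sub>1 * (d\<^sub>1 * S))) = 1"
      using arg_cong[OF S(2), of det] cc S(1) by (simp add: det_mult[of _ q] sm)
    then have "det S \<noteq> 0" using cc S(1) by (auto simp: det_mult[of _ q] sm)
    then show ?thesis by (simp add: det_const_ratmat)
  qed

  define c where "c = (\<lambda>i::nat. if i = 0 then c\<^sub>0 else c\<^sub>1)"
  define d where "d = (\<lambda>i::nat. if i = 0 then d\<^sub>0 else d\<^sub>1)"
  have cd: "c 0 = c\<^sub>0" "c (Suc 0) = c\<^sub>1" "d 0 = d\<^sub>0" "d (Suc 0) = d\<^sub>1"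
    by (simp_all add: c_def d_def)
  have "K_even c d 2 1 = mat_inv (?z \<cdot>\<^sub>m ?C c\<^sub>1 + mat_inv (?C d\<^sub>1 + 0\<^sub>m q q * mat_inv (1\<^sub>m q)))"
    using cc dC
    by (simp add: K_even.simps[of c d 2 "Suc 0"] cd const_ratmat_mat_inv mat_inv_eq[of "1\<^sub>m q" q "1\<^sub>m q"])
  also have "\<dots> = ?C d\<^sub>1 * mat_inv H\<^sub>1"
    by (rule continued_fraction_step)
       (use cc H1 dC in \<open>auto simp: H\<^sub>1_def const_ratmat_mult const_ratmat_one sm\<close>)
  finally have "K_even c d 2 0
      = mat_inv (?z \<cdot>\<^sub>m ?C c\<^sub>0 + mat_inv (?C d\<^sub>0 + ?C d\<^sub>1 * mat_inv H\<^sub>1))"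
    by (simp add: K_even.simps[of c d 2 0] cd)
  also have "\<dots> = G * mat_inv H"
  proof (rule continued_fraction_step)
    show "G = ?C d\<^sub>0 * H\<^sub>1 + ?C d\<^sub>1"
      using cc by (simp add: G_def H\<^sub>1_def sm cs assoc_add_mat[of _ q q])
    show "H = ?z \<cdot>\<^sub>m ?C c\<^sub>0 * G + H\<^sub>1"
      using cc by (simp add: H_def G_def H\<^sub>1_def sm cs assoc_add_mat[of _ q q])
  qed (use cc H1 G H in auto)
  also have "\<dots> = G * ?C S * mat_inv (H * ?C S)"
    by (rule right_fraction_cancel[symmetric]) (use G H S dS in auto)
  also have "G * ?C S = ?z \<cdot>\<^sub>m ?C (B 1) + ?C (B 3)"
    using cc S(1) unfolding B by (simp add: G_def sm cs)
  also have "H * ?C S = ?z \<cdot>\<^sub>m (?z \<cdot>\<^sub>m ?C (B 0) + ?C (B 2)) + ?C (B 4)"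
    using cc S(1) unfolding B S(2)[symmetric]
    by (simp add: H_def sm cs)
  finally have "ratmat (g_part q 4 ?F) * mat_inv (ratmat (h_part q 4 ?F)) = K_even c d 2 0"
    unfolding g h ..
  moreover have "\<forall>i<2. herm_posdef q (c i)" "\<forall>i<2. herm_posdef q (d i)"
    using pd by (auto simp: c_def d_def)
  ultimately show ?thesis
    using monic_mat_poly_mat_poly[of B q 4, OF B(1)] by (auto simp: HTM_poly_def)
qed

section \<open>A quartic with a coefficient of negative determinant\<close>

definition mat2 :: "complex \<Rightarrow> complex \<Rightarrow> complex \<Rightarrow> complex \<Rightarrow> complex mat" where
  "mat2 a b c d = mat 2 2 (\<lambda>(i, j). if i = 0 then if j = 0 then a else b else if j = 0 then c else d)"

lemma mat2_carrier [simp]: "mat2 a b c d \<in> carrier_mat 2 2"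
  by (simp add: mat2_def)

lemma mat2_add: "mat2 a b c d + mat2 a' b' c' d' = mat2 (a + a') (b + b') (c + c') (d + d')"
  by (auto simp: mat2_def)

lemma mat2_mult:
  "mat2 a b c d * mat2 a' b' c' d' = mat2 (a * a' + b * c') (a * b' + b * d') (c * a' + d * c') (c * b' + d * d')"
  by (rule eq_matI) (auto simp: mat2_def scalar_prod_def numeral_2_eq_2 less_Suc_eq)

lemma det_mat2: "det (mat2 a b c d) = a * d - b * c"
  by (subst laplace_expansion_column[of _ 2 0])
     (auto simp: mat2_def numeral_2_eq_2 cofactor_def mat_delete_def det_single)

text \<open>The quadratic form is \<open>\<bar>x - 4 y\<bar>\<^sup>2 + s \<bar>y\<bar>\<^sup>2\<close>.\<close>

lemma herm_posdef_mat2: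
  assumes s: "0 < s"
  shows "herm_posdef 2 (mat2 1 (- 4) (- 4) (16 + complex_of_real s))" (is "herm_posdef 2 ?M")
proof -
  have "mat_adjoint ?M = ?M"
    by (rule eq_matI) (auto simp: mat_adjoint_def mat_of_rows_def mat2_def less_2_cases_iff)
  moreover have "0 < (?M *\<^sub>v v) \<bullet>c v" if v: "v \<in> carrier_vec 2" "v \<noteq> 0\<^sub>v 2" for v
  proof -
    let ?x = "v $ 0" and ?y = "v $ 1"
    have "(?M *\<^sub>v v) \<bullet>c v = (?x - 4 * ?y) * cnj (?x - 4 * ?y) + s * (?y * cnj ?y)"
      using v(1) by (simp add: mat2_def scalar_prod_def numeral_2_eq_2 algebra_simps)
    also have "\<dots> = complex_of_real ((cmod (?x - 4 * ?y))\<^sup>2 + s * (cmod ?y)\<^sup>2)"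
      by (simp only: complex_norm_square of_real_add of_real_mult flip: complex_norm_square)
    also have "0 < \<dots>"
    proof -
      have "?x - 4 * ?y \<noteq> 0 \<or> ?y \<noteq> 0" using v by (auto simp: vec_eq_iff less_2_cases_iff)
      then have "0 < (cmod (?x - 4 * ?y))\<^sup>2 + s * (cmod ?y)\<^sup>2"
        using s by (auto intro: add_pos_nonneg add_nonneg_pos)
      then show ?thesis by (simp add: less_complex_def)
    qed
    finally show ?thesis .
  qed
  ultimately show ?thesis by (simp add: herm_posdef_def)
qed

text \<open>
  Up to factors of positive determinant, \<open>c\<^sub>0 (d\<^sub>0 + d\<^sub>1) + c\<^sub>1 d\<^sub>1\<close> is \<open>1 + P + Q\<close> with
  \<open>P = c\<^sub>0\<^sup>-\<^sup>1 c\<^sub>1\<close> and \<open>Q = d\<^sub>0 d\<^sub>1\<^sup>-\<^sup>1\<close>.  A quotient of two positive definite matrices can be any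
  diagonalizable matrix with positive eigenvalues.  The choice \<open>P = mat2 1 4 0 2\<close> with \<open>Q\<close> its
  transpose gives \<open>1 + P + Q = mat2 3 4 4 5\<close>, whose determinant is \<open>-1\<close>.  It is realized by
  \<open>c\<^sub>0 = d\<^sub>1 = X\<close> and \<open>c\<^sub>1 = d\<^sub>0 = Y\<close>.
\<close>

lemma HTM_poly_4_negative_coeff_det:
  "\<exists>F. HTM_poly 2 4 F \<and> det (mp_coeff 4 F 2) < 0"
proof -
  define X where "X = mat2 1 (- 4) (- 4) 17"
  define Y where "Y = mat2 1 (- 4) (- 4) 18"
  have pd: "herm_posdef 2 X" "herm_posdef 2 Y"
    using herm_posdef_mat2[of 1] herm_posdef_mat2[of 2] by (simp_all add: X_def Y_def)
  have cc: "X \<in> carrier_mat 2 2" "Y \<in> carrier_mat 2 2" by (simp_all add: X_def Y_def)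
  define S where "S = mat_inv (X * (Y * (Y * X)))"
  have det: "det X = 1" "det Y = 2" by (simp_all add: X_def Y_def det_mat2)
  have P: "X * (Y * (Y * X)) \<in> carrier_mat 2 2" "det (X * (Y * (Y * X))) = 4"
    using cc det by (simp_all add: det_mult[of _ 2] square_mat_simps[where q = 2])
  have S: "S \<in> carrier_mat 2 2" "X * (Y * (Y * X)) * S = 1\<^sub>m 2"
    using mat_inv_nonsingular[of _ 2, OF P(1)] P(2) by (simp_all add: S_def)
  define B where "B = nth [1\<^sub>m 2, Y * (Y * (X * S)), (X * (Y + X) + Y * X) * S, (Y + X) * S, S]"
  have "HTM_poly 2 4 (mat_poly 2 4 B)"
    by (rule HTM_poly_4I[of 2 X Y Y X S])
       (use pd cc S in \<open>auto simp: B_def square_mat_simps[where q = 2]\<close>)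
  moreover have "det (mp_coeff 4 (mat_poly 2 4 B) 2) < 0"
  proof -
    define M where "M = X * (Y + X) + Y * X"
    have M: "M \<in> carrier_mat 2 2" "det M = - 1"
      using cc by (simp_all add: M_def X_def Y_def mat2_mult mat2_add det_mat2)
    have "4 * det S = 1"
      using arg_cong[OF S(2), of det] P S(1) by (simp add: det_mult[of _ 2])
    then have "det S = 1 / 4" by (simp add: field_simps)
    then have "det (M * S) = - 1 / 4" using M S(1) by (simp add: det_mult[of _ 2])
    moreover have "mp_coeff 4 (mat_poly 2 4 B) 2 = M * S"
      using M S(1) by (subst mp_coeff_mat_poly) (auto simp: B_def M_def)
    ultimately show ?thesis by (simp add: less_complex_def)
  qed
  ultimately show ?thesis by blast
qed

theorem theorem6p2:
  shows "(\<forall>q::nat. 1 \<le> q \<longrightarrow> (\<forall>n\<in>{1, 2, 3::nat}. \<forall>F. HTM_poly q n F \<longrightarrow>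
            (\<forall>j\<in>{0..n}. 0 < det (mp_coeff n F j)))) \<and>
         (\<exists>q::nat. 1 \<le> q \<and> (\<exists>F. HTM_poly q 4 F \<and>
            (\<exists>j\<in>{0..4}. det (mp_coeff 4 F j) < 0)))"
proof (intro conjI allI impI ballI)
  show "0 < det (mp_coeff n F j)" if "n \<in> {1, 2, 3}" "HTM_poly q n F" "j \<in> {0..n}" for q n F j
    using that by (intro HTM_poly_upto_3_det_pos) auto
  obtain F where "HTM_poly 2 4 F" "det (mp_coeff 4 F 2) < 0"
    using HTM_poly_4_negative_coeff_det by blast
  then show "\<exists>q::nat. 1 \<le> q \<and> (\<exists>F. HTM_poly q 4 F \<and> (\<exists>j\<in>{0..4}. det (mp_coeff 4 F j) < 0))"
    by (intro exI[of _ 2] conjI exI[of _ F] bexI[of _ 2]) auto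
qed

end
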